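(* Let $A,C$ be real $n\times n$ matrices with $C$ invertible and let $\lambda\in\mathbb{R}^n$ be nonzero. Suppose that the linear hybrid system $$\begin{cases}\dot x=Ax, & \lambda^\top x\neq0,\\ x^+=Cx, & \lambda^\top x=0,\end{cases}$$ is trivially blocking. Then for any initial condition $x_0\neq0$, the resulting trajectory is not Zeno.
   Context: Let $\Sigma=\{x\in\mathbb{R}^n:\lambda^\top x=0\}$ be the guard. For $k\in\mathbb{N}$ let $\Sigma_k:=\bigcap_{j=0}^{k}\{x:\lambda^\top C^jx=0\}$ and $\Sigma_\infty:=\bigcap_{k\ge0}\Sigma_k$. The system is trivially blocking if $\Sigma_\infty=\{0\}$. A set $E\subset\mathbb{R}\times\mathbb{N}$ is a compact hybrid time domain if $E=\bigcup_{j=0}^{J-1}[t_j,t_{j+1}]\times\{j\}$ for some finite sequence $t_0\le t_1\le\dots\le t_J$ (take $t_0=0$). A set $E$ is a hybrid time domain if for all $(T,J)\in E$, $E\cap([0,T]\times\{0,\dots,J\})$ is a compact hybrid time domain. Let $\pi_1:E\to\mathbb{R}$ and $\pi_2:E\to\mathbb{N}$ be the projections, and let $I^j=\pi_1(\pi_2^{-1}(j))$. A hybrid arc is a function $\varphi:E\to\mathbb{R}^n$ on a hybrid time domain such that each $t\mapsto\varphi(t,j)$ is locally absolutely continuous on $I^j$. A hybrid arc $\varphi:E\to\mathbb{R}^n$ is a solution (trajectory) of the system if (1) for every $j$ such that $I^j$ has nonempty interior, $\varphi(t,j)\notin\Sigma$ for $t\in\mathrm{int}(I^j)$ and $\frac{d}{dt}\varphi(t,j)=A\varphi(t,j)$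 for almost every $t\in I^j$; and (2) whenever $(t,j),(t,j+1)\in E$, $\varphi(t,j)\in\Sigma$ and $\varphi(t,j+1)=C\varphi(t,j)$. The initial condition is the value of $\varphi$ at the start of $E$. A solution $\varphi:E\to\mathbb{R}^n$ is Zeno if $\pi_1(E)$ is bounded, $\pi_2(E)$ is unbounded, and $\pi_1(\pi_2^{-1}(j))$ has nonempty interior for infinitely many $j$. *)

theory Defs
  imports "HOL-Analysis.Analysis"
begin

text \<open>The operations \<open>*\<close> and \<open>^\<close> on \<^typ>\<open>real^'n^'n\<close> are componentwise, so powers with respect to
  \<open>**\<close> need their own definition.\<close>

primrec matrix_power :: "real^'n^'n \<Rightarrow> nat \<Rightarrow> real^'n^'n" where
  "matrix_power C 0 = mat 1"
| "matrix_power C (Suc k) = C ** matrix_power C k"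

definition guard :: "real^'n \<Rightarrow> (real^'n) set" where
  "guard lam = {x. lam \<bullet> x = 0}"

definition blocking_set :: "real^'n^'n \<Rightarrow> real^'n \<Rightarrow> nat \<Rightarrow> (real^'n) set" where
  "blocking_set C lam k = (\<Inter>j\<in>{0..k}. {x. lam \<bullet> (matrix_power C j *v x) = 0})"

definition blocking_set_inf :: "real^'n^'n \<Rightarrow> real^'n \<Rightarrow> (real^'n) set" where
  "blocking_set_inf C lam = (\<Inter>k. blocking_set C lam k)"

definition trivially_blocking :: "real^'n^'n \<Rightarrow> real^'n \<Rightarrow> bool" where
  "trivially_blocking C lam \<longleftrightarrow> blocking_set_inf C lam = {0}"

text \<open>The union over \<open>j = 0, \<dots>, J - 1\<close> is taken with \<open>J \<ge> 1\<close>, so compact hybrid time domains are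
  nonempty and contain \<open>(0, 0)\<close>. With \<open>J = 0\<close> allowed, the empty set would be a compact hybrid time
  domain, and arbitrary sets of negative times would become hybrid time domains.\<close>

definition compact_hybrid_time_domain :: "(real \<times> nat) set \<Rightarrow> bool" where
  "compact_hybrid_time_domain E \<longleftrightarrow>
     (\<exists>(J::nat) (t::nat \<Rightarrow> real). J \<ge> 1 \<and> t 0 = 0 \<and> (\<forall>j<J. t j \<le> t (Suc j)) \<and>
        E = (\<Union>j\<in>{0..<J}. {t j..t (Suc j)} \<times> {j}))"

definition hybrid_time_domain :: "(real \<times> nat) set \<Rightarrow> bool" where
  "hybrid_time_domain E \<longleftrightarrow>
     (\<forall>(T, J)\<in>E. compact_hybrid_time_domain (E \<inter> ({0..T} \<times> {0..J})))"

definition time_slice :: "(real \<times> nat) set \<Rightarrow> nat \<Rightarrow> real set" where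
  "time_slice E j = fst ` {p \<in> E. snd p = j}"

definition absolutely_continuous_fun_on ::
    "real set \<Rightarrow> (real \<Rightarrow> 'a::real_normed_vector) \<Rightarrow> bool" where
  "absolutely_continuous_fun_on S f \<longleftrightarrow>
     (\<forall>\<epsilon>>0. \<exists>\<delta>>0. \<forall>P :: (real \<times> real) set.
        finite P \<longrightarrow>
        (\<forall>(a, b)\<in>P. a < b \<and> {a..b} \<subseteq> S) \<longrightarrow>
        disjoint_family_on (\<lambda>(a, b). {a<..<b}) P \<longrightarrow>
        (\<Sum>(a, b)\<in>P. b - a) < \<delta> \<longrightarrow>
        (\<Sum>(a, b)\<in>P. norm (f b - f a)) < \<epsilon>)"

definition locally_absolutely_continuous_on ::
    "real set \<Rightarrow> (real \<Rightarrow> 'a::real_normed_vector) \<Rightarrow> bool" where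
  "locally_absolutely_continuous_on I f \<longleftrightarrow>
     (\<forall>a b. {a..b} \<subseteq> I \<longrightarrow> absolutely_continuous_fun_on {a..b} f)"

text \<open>An arc with domain \<open>E\<close> is a total function whose values outside \<open>E\<close> are irrelevant.\<close>

definition hybrid_arc :: "(real \<times> nat) set \<Rightarrow> (real \<times> nat \<Rightarrow> real^'n) \<Rightarrow> bool" where
  "hybrid_arc E \<phi> \<longleftrightarrow> hybrid_time_domain E \<and>
     (\<forall>j. locally_absolutely_continuous_on (time_slice E j) (\<lambda>t. \<phi> (t, j)))"

definition hybrid_solution ::
    "real^'n^'n \<Rightarrow> real^'n^'n \<Rightarrow> real^'n \<Rightarrow> (real \<times> nat) set \<Rightarrow> (real \<times> nat \<Rightarrow> real^'n) \<Rightarrow> bool" where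
  "hybrid_solution A C lam E \<phi> \<longleftrightarrow> hybrid_arc E \<phi> \<and>
     (\<forall>j. interior (time_slice E j) \<noteq> {} \<longrightarrow>
        (\<forall>t\<in>interior (time_slice E j). \<phi> (t, j) \<notin> guard lam) \<and>
        (AE t in lebesgue. t \<in> time_slice E j \<longrightarrow>
           ((\<lambda>s. \<phi> (s, j)) has_vector_derivative (A *v \<phi> (t, j))) (at t within time_slice E j))) \<and>
     (\<forall>t j. (t, j) \<in> E \<longrightarrow> (t, Suc j) \<in> E \<longrightarrow>
        \<phi> (t, j) \<in> guard lam \<and> \<phi> (t, Suc j) = C *v \<phi> (t, j))"

definition zeno_solution ::
    "real^'n^'n \<Rightarrow> real^'n^'n \<Rightarrow> real^'n \<Rightarrow> (real \<times> nat) set \<Rightarrow> (real \<times> nat \<Rightarrow> real^'n) \<Rightarrow> bool" where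
  "zeno_solution A C lam E \<phi> \<longleftrightarrow> hybrid_solution A C lam E \<phi> \<and>
     bounded (fst ` E) \<and> \<not> bdd_above (snd ` E) \<and>
     infinite {j. interior (time_slice E j) \<noteq> {}}"

end

theory Submission
  imports Defs
begin

text \<open>Infinitely many jumps in bounded time force, for every \<open>m\<close>, a block of \<open>m\<close> consecutive jumps
  whose intermediate flows have length \<open>O(1 / m)\<close>, so that consecutive pre-jump states
  \<open>y\<close> and \<open>y'\<close> satisfy \<open>y' = C y\<close> up to a small relative error. The dynamics being linear, the first
  state of each block can be normalised (it is nonzero because flows and \<open>C\<close> are injective). A limit
  point \<open>u\<close> on the unit sphere then has \<open>C\<^sup>i u\<close> in the guard for all \<open>i\<close>, that is, \<open>u\<close> lies in the
  trivial set \<open>\<Sigma>\<^sub>\<infinity>\<close>.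

  Hybrid time domains in the sense of the definition may branch, so jump times are only taken from a
  compact piece of the domain, long enough for the given \<open>m\<close>.\<close>

section \<open>Absolutely continuous functions and their derivatives\<close>

text \<open>Cousin's lemma reduces the estimate to a fine tagged division: intervals tagged outside \<open>N\<close> are
  controlled by the derivative, those tagged in \<open>N\<close> lie in an open set of small measure and are
  controlled by absolute continuity.\<close>

lemma absolutely_continuous_fun_on_derivative_bound:
  fixes f :: "real \<Rightarrow> 'a::real_normed_vector"
  assumes ab: "a \<le> b" and ac: "absolutely_continuous_fun_on {a..b} f" and N: "negligible N"
    and der: "\<And>x. x \<in> {a..b} - N \<Longrightarrow> (f has_vector_derivative f' x) (at x within {a..b})"
    and L: "\<And>x. x \<in> {a..b} - N \<Longrightarrow> norm (f' x) \<le> L" and L0: "0 \<le> L"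
  shows "norm (f b - f a) \<le> L * (b - a)"
proof (rule field_le_epsilon)
  fix e :: real assume e: "e > 0"
  then obtain \<delta> where \<delta>: "\<delta> > 0" and acD: "\<And>P :: (real \<times> real) set. finite P \<Longrightarrow>
        (\<forall>(u, v)\<in>P. u < v \<and> {u..v} \<subseteq> {a..b}) \<Longrightarrow>
        disjoint_family_on (\<lambda>(u, v). {u<..<v}) P \<Longrightarrow>
        (\<Sum>(u, v)\<in>P. v - u) < \<delta> \<Longrightarrow> (\<Sum>(u, v)\<in>P. norm (f v - f u)) < e / 2"
    using ac half_gt_zero[OF e] unfolding absolutely_continuous_fun_on_def by blast
  have Nn: "N \<in> null_sets lebesgue" using N by (simp add: negligible_iff_null_sets)
  \<comment> \<open>A null set has open neighbourhoods of arbitrarily small measure;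
    \<open>\<delta>\<close> is the length below which absolute continuity keeps the total increment
    under \<open>e / 2\<close>.\<close>
  obtain U where U: "open U" "N \<subseteq> U" "U \<in> lmeasurable" "measure lebesgue U < \<delta>"
  proof -
    from Nn obtain T where T: "open T" "N \<subseteq> T" "T - N \<in> lmeasurable" "emeasure lebesgue (T - N) < ennreal \<delta>"
      using sets_lebesgue_outer_open[OF _ \<delta>] by (metis null_setsD2)
    have "T = (T - N) \<union> N" using T by auto
    then have "T \<in> lmeasurable"
      using T(3) N by (metis fmeasurable.Un negligible_imp_measurable)
    moreover have "emeasure lebesgue T < ennreal \<delta>"
      using T(1,4) Nn emeasure_Diff_null_set[OF Nn] by (simp add: lmeasurable_open)
    ultimately have "measure lebesgue T < \<delta>"
      using \<delta> by (simp add: emeasure_eq_measure2 ennreal_less_iff)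
    with T(1,2) \<open>T \<in> lmeasurable\<close> that show thesis by blast
  qed
  \<comment> \<open>The other half of \<open>e\<close> pays for the derivative errors summed over
    the division; the \<open>+ 1\<close> keeps the denominator positive when
    \<open>a = b\<close>.\<close>
  define \<eta> where "\<eta> = e / (2 * (b - a + 1))"
  have \<eta>: "\<eta> > 0" "\<eta> * (b - a) \<le> e / 2"
    using e ab by (auto simp: \<eta>_def field_simps)
  \<comment> \<open>This radius defines the gauge: around points of \<open>N\<close> the ball stays
    in \<open>U\<close>, around the other points of \<open>{a..b}\<close> the linear approximation
    is accurate up to \<open>\<eta>\<close>, and elsewhere any radius serves.\<close>
  have "\<exists>d>0. (x \<in> N \<longrightarrow> ball x d \<subseteq> U) \<and> (x \<in> {a..b} - N \<longrightarrow> (\<forall>y\<in>{a..b}. norm (y - x) < d \<longrightarrow>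
          norm (f y - f x - (y - x) *\<^sub>R f' x) \<le> \<eta> * norm (y - x)))" for x
  proof (cases "x \<in> N")
    case True
    then show ?thesis using U(1,2) by (metis DiffD2 openE subsetD)
  next
    case False
    show ?thesis
    proof (cases "x \<in> {a..b}")
      case True
      with False der[of x] \<eta>(1) show ?thesis
        unfolding has_vector_derivative_def has_derivative_within_alt by auto
    qed (use False in \<open>auto intro: exI[of _ 1]\<close>)
  qed
  then obtain d where d: "\<And>x. d x > 0" "\<And>x. x \<in> N \<Longrightarrow> ball x (d x) \<subseteq> U"
    "\<And>x y. \<lbrakk>x \<in> {a..b} - N; y \<in> {a..b}; norm (y - x) < d x\<rbrakk> \<Longrightarrow>
          norm (f y - f x - (y - x) *\<^sub>R f' x) \<le> \<eta> * norm (y - x)" by metis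
  have "gauge (\<lambda>x. ball x (d x))" using d(1) by (simp add: gauge_def)
  then obtain p where p: "p tagged_division_of {a..b}" "(\<lambda>x. ball x (d x)) fine p"
    using fine_division_exists_real by blast
  note pD = tagged_division_ofD[OF p(1)]
  have pK: "interior K = {Inf K<..<Sup K}" "Inf K \<le> x" "x \<le> Sup K"
      "{Inf K..Sup K} \<subseteq> {a..b}" "{Inf K..Sup K} \<subseteq> ball x (d x)"
    if xKp: "(x, K) \<in> p" for x K
  proof -
    obtain u v where K: "K = {u..v}" using pD(4)[OF xKp] by auto
    then have "u \<le> x" "x \<le> v" using pD(2)[OF xKp] by auto
    then have IS: "Inf K = u" "Sup K = v" unfolding K by auto
    with \<open>u \<le> x\<close> \<open>x \<le> v\<close> show "Inf K \<le> x" "x \<le> Sup K" by auto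
    show "interior K = {Inf K<..<Sup K}" unfolding IS unfolding K by (rule interior_atLeastAtMost_real)
    have "K \<subseteq> {a..b}" "K \<subseteq> ball x (d x)" using pD(3)[OF xKp] p(2) xKp by (auto simp: fine_def)
    then show "{Inf K..Sup K} \<subseteq> {a..b}" "{Inf K..Sup K} \<subseteq> ball x (d x)"
      unfolding IS unfolding K by auto
  qed
  define S where "S = {z\<in>p. fst z \<in> N}"
  \<comment> \<open>A tagged division may contain degenerate intervals, whose increment is 0; they
    are dropped because absolute continuity speaks of intervals with \<open>u < v\<close>.\<close>
  define S' where "S' = {z\<in>S. Inf (snd z) < Sup (snd z)}"
  have fin: "finite p" "finite S" "finite S'" using pD(1) by (auto simp: S_def S'_def)
  let ?g = "\<lambda>(x::real, K::real set). f (Sup K) - f (Inf K)"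
  have split: "f b - f a = sum ?g S + sum ?g (p - S)"
    using additive_tagged_division_1[OF ab p(1), of f] sum.subset_diff[of S p ?g] fin
    by (simp add: S_def add.commute)
  have good: "norm (sum ?g (p - S)) \<le> (L + \<eta>) * (b - a)"
  proof -
    have "norm (?g z) \<le> (case z of (x, K) \<Rightarrow> (L + \<eta>) * (Sup K - Inf K))" if "z \<in> p - S" for z
    proof -
      obtain x K where z: "z = (x, K)" by force
      then have xK: "(x, K) \<in> p" "x \<notin> N" using that by (auto simp: S_def)
      define u v where "u = Inf K" and "v = Sup K"
      have uv: "u \<le> x" "x \<le> v" "{u..v} \<subseteq> {a..b}" "{u..v} \<subseteq> ball x (d x)"
        using pK[OF xK(1)] by (simp_all add: u_def v_def)
      have uvx: "u \<in> {u..v}" "v \<in> {u..v}" "x \<in> {u..v}" using uv by auto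
      have x: "x \<in> {a..b} - N" using uv uvx xK by blast
      have A: "norm (f v - f x - (v - x) *\<^sub>R f' x) \<le> \<eta> * norm (v - x)"
        "norm (f u - f x - (u - x) *\<^sub>R f' x) \<le> \<eta> * norm (u - x)"
      proof -
        have "v \<in> {a..b}" "u \<in> {a..b}" "v \<in> ball x (d x)" "u \<in> ball x (d x)"
          using uv(3,4) uvx by blast+
        then show "norm (f v - f x - (v - x) *\<^sub>R f' x) \<le> \<eta> * norm (v - x)"
          "norm (f u - f x - (u - x) *\<^sub>R f' x) \<le> \<eta> * norm (u - x)"
          by (intro d(3)[OF x]; simp add: dist_norm norm_minus_commute)+
      qed
      \<comment> \<open>The derivative is known at the tag \<open>x\<close> only, so both ends are
        compared with \<open>x\<close>; since \<open>x\<close> lies between them, the two errors add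
        up to \<open>\<eta> * (v - u)\<close>.\<close>
      have eq: "f v - f u = (f v - f x - (v - x) *\<^sub>R f' x) - (f u - f x - (u - x) *\<^sub>R f' x)
          + (v - u) *\<^sub>R f' x" (is "_ = ?p - ?q + ?r")
        by (simp add: algebra_simps)
      have "norm (f v - f u) \<le> norm ?p + norm ?q + norm ?r"
        unfolding eq using norm_triangle_ineq[of "?p - ?q" ?r] norm_triangle_ineq4[of ?p ?q] by linarith
      also have "\<dots> \<le> \<eta> * (v - x) + \<eta> * (x - u) + (v - u) * L"
        using A uv L[OF x] by (intro add_mono) (auto intro: mult_left_mono)
      also have "\<dots> = (L + \<eta>) * (v - u)" by (simp add: algebra_simps)
      finally show ?thesis by (simp add: z u_def v_def)
    qed
    then have "norm (sum ?g (p - S)) \<le> (\<Sum>(x, K)\<in>p - S. (L + \<eta>) * (Sup K - Inf K))"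
      by (rule sum_norm_le)
    \<comment> \<open>Putting back the nonnegative terms tagged in \<open>N\<close> makes the
      lengths telescope to \<open>b - a\<close>.\<close>
    also have "\<dots> \<le> (\<Sum>(x, K)\<in>p. (L + \<eta>) * (Sup K - Inf K))"
    proof (rule sum_mono2)
      fix z assume "z \<in> p - (p - S)"
      then have "Inf (snd z) \<le> Sup (snd z)"
        using pK(2,3)[of "fst z" "snd z"] by (simp add: split_beta)
      then show "0 \<le> (case z of (x, K) \<Rightarrow> (L + \<eta>) * (Sup K - Inf K))"
        using L0 \<eta>(1) by (simp add: split_beta)
    qed (use fin in auto)
    also have "\<dots> = (L + \<eta>) * (b - a)"
      using additive_tagged_division_1[OF ab p(1), of "\<lambda>x. x"]
      by (simp add: split_beta sum_distrib_left[symmetric])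
    finally show ?thesis .
  qed
  have bad: "norm (sum ?g S) \<le> e / 2"
  proof -
    let ?h = "\<lambda>(x::real, K::real set). (Inf K, Sup K)"
    have S'K: "(x, K) \<in> p" "Inf K < Sup K" "{Inf K..Sup K} \<subseteq> {a..b}" "{Inf K..Sup K} \<subseteq> U"
      if "(x, K) \<in> S'" for x K
    proof -
      show xK: "(x, K) \<in> p" and "Inf K < Sup K" using that by (auto simp: S'_def S_def)
      have "x \<in> N" using that by (auto simp: S'_def S_def)
      then show "{Inf K..Sup K} \<subseteq> {a..b}" "{Inf K..Sup K} \<subseteq> U"
        using pK(4,5)[OF xK] d(2)[of x] by blast+
    qed
    have disj: "{Inf K<..<Sup K} \<inter> {Inf K'<..<Sup K'} = {}"
      if z: "(x, K) \<in> S'" "(x', K') \<in> S'" "(x, K) \<noteq> (x', K')" for x K x' K'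
      using pD(5)[OF S'K(1)[OF z(1)] S'K(1)[OF z(2)] z(3)]
      unfolding pK(1)[OF S'K(1)[OF z(1)]] pK(1)[OF S'K(1)[OF z(2)]] .
    \<comment> \<open>Equal end points would mean equal nonempty interiors, against disjointness.
      Injectivity allows the sum over end point pairs to be reindexed over
      \<open>S'\<close>.\<close>
    have inj: "inj_on ?h S'"
    proof (rule inj_onI)
      fix z z' assume z: "z \<in> S'" "z' \<in> S'" "?h z = ?h z'"
      obtain x K x' K' where zz: "z = (x, K)" "z' = (x', K')" by force
      have "{Inf K<..<Sup K} \<inter> {Inf K'<..<Sup K'} = {Inf K<..<Sup K}" using z(3) zz by auto
      moreover have "Inf K < Sup K" using S'K(2)[of x K] z(1) zz by simp
      ultimately show "z = z'" using disj[of x K x' K'] z(1,2) zz by auto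
    qed
    define P where "P = ?h ` S'"
    have Pd: "disjoint_family_on (\<lambda>(u, v). {u<..<v}) P"
      unfolding disjoint_family_on_def
    proof (intro ballI impI)
      fix w w' assume w: "w \<in> P" "w' \<in> P" "w \<noteq> w'"
      then obtain x K x' K' where "(x, K) \<in> S'" "(x', K') \<in> S'"
        "w = (Inf K, Sup K)" "w' = (Inf K', Sup K')" unfolding P_def by auto
      then show "(case w of (u, v) \<Rightarrow> {u<..<v}) \<inter> (case w' of (u, v) \<Rightarrow> {u<..<v}) = {}"
        using disj[of x K x' K'] w(3) by auto
    qed
    have PU: "\<forall>(u, v)\<in>P. u < v \<and> {u..v} \<subseteq> {a..b} \<and> {u..v} \<subseteq> U"
    proof
      fix w assume "w \<in> P"
      then obtain x K where "(x, K) \<in> S'" "w = (Inf K, Sup K)" unfolding P_def by auto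
      then show "case w of (u, v) \<Rightarrow> u < v \<and> {u..v} \<subseteq> {a..b} \<and> {u..v} \<subseteq> U"
        using S'K(2-4)[of x K] by (simp only: prod.case simp_thms)
    qed
    \<comment> \<open>Disjointness turns the total length into the measure of a union contained in
      \<open>U\<close>.\<close>
    have "(\<Sum>(u, v)\<in>P. v - u) = (\<Sum>z\<in>P. measure lebesgue (case z of (u, v) \<Rightarrow> {u<..<v}))"
      using PU by (intro sum.cong) auto
    also have "\<dots> = measure lebesgue (\<Union>((\<lambda>(u, v). {u<..<v}) ` P))"
      by (rule measure_negligible_finite_Union_image[symmetric])
         (use Pd fin in \<open>auto simp: P_def pairwise_def disjoint_family_on_def\<close>)
    also have "\<dots> \<le> measure lebesgue U"
    proof (rule measure_mono_fmeasurable)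
      show "\<Union> ((\<lambda>(u, v). {u<..<v}) ` P) \<subseteq> U"
      proof (rule UN_least)
        fix w assume "w \<in> P"
        moreover obtain u v where "w = (u, v)" by force
        ultimately have "{u..v} \<subseteq> U" "w = (u, v)" using PU by auto
        then show "(case w of (u, v) \<Rightarrow> {u<..<v}) \<subseteq> U"
          using greaterThanLessThan_subseteq_atLeastAtMost_iff[of u v u v] by simp
      qed
      show "\<Union> ((\<lambda>(u, v). {u<..<v}) ` P) \<in> sets lebesgue"
        using fin by (auto simp: P_def)
    qed (use U in auto)
    also have "\<dots> < \<delta>" by (rule U)
    finally have "(\<Sum>(u, v)\<in>P. norm (f v - f u)) < e / 2"
      using PU Pd fin by (intro acD) (auto simp: P_def)
    moreover have "(\<Sum>(u, v)\<in>P. norm (f v - f u)) = (\<Sum>z\<in>S'. norm (?g z))"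
      unfolding P_def by (subst sum.reindex[OF inj]) (auto intro!: sum.cong)
    moreover have "sum ?g S = sum ?g S'"
    proof (rule sum.mono_neutral_right)
      show "\<forall>i\<in>S - S'. ?g i = 0"
      proof
        fix z assume z: "z \<in> S - S'"
        obtain x K where xK: "z = (x, K)" by force
        then have "Inf K = Sup K" using z pK(2,3)[of x K] by (auto simp: S'_def S_def)
        then show "?g z = 0" by (simp add: xK)
      qed
    qed (use fin in \<open>auto simp: S'_def\<close>)
    ultimately show ?thesis using norm_sum[of ?g S'] by simp
  qed
  have "norm (f b - f a) \<le> norm (sum ?g S) + norm (sum ?g (p - S))"
    unfolding split by (rule norm_triangle_ineq)
  also have "\<dots> \<le> e / 2 + (L + \<eta>) * (b - a)" using good bad by simp
  also have "\<dots> \<le> L * (b - a) + e" using \<eta>(2) by (simp add: algebra_simps)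
  finally show "norm (f b - f a) \<le> L * (b - a) + e" .
qed

lemma absolutely_continuous_fun_on_subset:
  "absolutely_continuous_fun_on S f \<Longrightarrow> T \<subseteq> S \<Longrightarrow> absolutely_continuous_fun_on T f"
  unfolding absolutely_continuous_fun_on_def split_beta by (meson order_trans)

lemma absolutely_continuous_fun_on_imp_continuous_on:
  assumes "absolutely_continuous_fun_on {a..b} f"
  shows "continuous_on {a..b} f"
  unfolding continuous_on_iff
proof (intro ballI allI impI)
  fix x e :: real assume x: "x \<in> {a..b}" and e: "e > 0"
  obtain \<delta> where \<delta>: "\<delta> > 0" and acD: "\<And>P :: (real \<times> real) set. finite P \<Longrightarrow>
        (\<forall>(u, v)\<in>P. u < v \<and> {u..v} \<subseteq> {a..b}) \<Longrightarrow>
        disjoint_family_on (\<lambda>(u, v). {u<..<v}) P \<Longrightarrow>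
        (\<Sum>(u, v)\<in>P. v - u) < \<delta> \<Longrightarrow> (\<Sum>(u, v)\<in>P. norm (f v - f u)) < e"
    using assms e unfolding absolutely_continuous_fun_on_def by blast
  have *: "norm (f v - f u) < e" if "u < v" "{u..v} \<subseteq> {a..b}" "v - u < \<delta>" for u v
    using acD[of "{(u, v)}"] that by (auto simp: disjoint_family_on_def)
  have "dist (f y) (f x) < e" if y: "y \<in> {a..b}" "dist y x < \<delta>" for y
  proof (cases x y rule: linorder_cases)
    case less then show ?thesis using *[of x y] x y by (auto simp: dist_norm)
  next
    case greater then show ?thesis using *[of y x] x y by (auto simp: dist_norm norm_minus_commute)
  qed (use e in auto)
  then show "\<exists>d>0. \<forall>y\<in>{a..b}. dist y x < d \<longrightarrow> dist (f y) (f x) < e" using \<delta> by blast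
qed

section \<open>Short-time estimates for Caratheodory solutions\<close>

text \<open>Isolates the flow equation from the guard and the jumps. Taking the derivative within
  \<open>S\<close> makes the notion pass to subintervals.\<close>

definition caratheodory_solution_on :: "real set \<Rightarrow> ('a \<Rightarrow> 'a::real_normed_vector) \<Rightarrow> (real \<Rightarrow> 'a) \<Rightarrow> bool" where
  "caratheodory_solution_on S F f \<longleftrightarrow> absolutely_continuous_fun_on S f \<and>
     (\<exists>N. negligible N \<and> (\<forall>t\<in>S - N. (f has_vector_derivative F (f t)) (at t within S)))"

lemma caratheodory_solution_on_subset:
  "caratheodory_solution_on S F f \<Longrightarrow> T \<subseteq> S \<Longrightarrow> caratheodory_solution_on T F f"
  unfolding caratheodory_solution_on_def
  by (auto intro: absolutely_continuous_fun_on_subset has_vector_derivative_within_subset)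

text \<open>On so short an interval the solution moves by at most half of its maximal norm, so this
  maximum is at most twice the norm at either end. Inserted into the mean value estimate, this makes
  the displacement relative to the initial state.\<close>

lemma caratheodory_solution_short_time:
  fixes F :: "'a::real_normed_vector \<Rightarrow> 'a"
  assumes sol: "caratheodory_solution_on {a..b} F f" and ab: "a \<le> b"
    and K: "\<And>x. norm (F x) \<le> K * norm x" and K0: "0 \<le> K" and short: "K * (b - a) \<le> 1 / 2"
  shows "norm (f b - f a) \<le> 2 * K * (b - a) * norm (f a)" and "f b = 0 \<Longrightarrow> f a = 0"
proof -
  obtain N where N: "negligible N"
    and der: "\<And>t. t \<in> {a..b} - N \<Longrightarrow> (f has_vector_derivative F (f t)) (at t within {a..b})"
    and ac: "absolutely_continuous_fun_on {a..b} f"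
    using sol unfolding caratheodory_solution_on_def by blast
  have "continuous_on {a..b} (\<lambda>t. norm (f t))"
    using absolutely_continuous_fun_on_imp_continuous_on[OF ac] by (rule continuous_on_norm)
  then obtain m where m: "m \<in> {a..b}" "\<And>t. t \<in> {a..b} \<Longrightarrow> norm (f t) \<le> norm (f m)"
    using continuous_attains_sup[of "{a..b}" "\<lambda>t. norm (f t)"] ab by auto
  \<comment> \<open>Subintervals are allowed because the estimate is applied on both sides of the
    maximum point \<open>m\<close>.\<close>
  have est: "norm (f d - f c) \<le> K * (b - a) * norm (f m)" if "a \<le> c" "c \<le> d" "d \<le> b" for c d
  proof -
    have sub: "{c..d} \<subseteq> {a..b}" using that by auto
    have "norm (f d - f c) \<le> K * norm (f m) * (d - c)"
    proof (rule absolutely_continuous_fun_on_derivative_bound[OF that(2)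
          absolutely_continuous_fun_on_subset[OF ac sub] N])
      fix x assume x: "x \<in> {c..d} - N"
      then show "(f has_vector_derivative F (f x)) (at x within {c..d})"
        using der sub by (blast intro: has_vector_derivative_within_subset)
      show "norm (F (f x)) \<le> K * norm (f m)"
        using K[of "f x"] m(2)[of x] x sub K0 by (meson DiffD1 mult_left_mono order_trans subsetD)
    qed (use K0 in auto)
    also have "\<dots> \<le> K * norm (f m) * (b - a)"
      using that K0 by (intro mult_left_mono) auto
    finally show ?thesis by (simp add: mult_ac)
  qed
  have "norm (f m - f c) \<le> 1 / 2 * norm (f m)" if "c \<in> {a, b}" for c
  proof -
    have "norm (f m - f c) \<le> K * (b - a) * norm (f m)"
      using that est[of a m] est[of m b] m(1) by (auto simp: norm_minus_commute)
    also have "\<dots> \<le> 1 / 2 * norm (f m)" by (intro mult_right_mono short) auto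
    finally show ?thesis .
  qed
  then have half: "norm (f m) \<le> 2 * norm (f c)" if "c \<in> {a, b}" for c
    using that norm_triangle_sub[of "f m" "f c"] by fastforce
  have "norm (f b - f a) \<le> K * (b - a) * norm (f m)" using est[of a b] ab by simp
  also have "\<dots> \<le> K * (b - a) * (2 * norm (f a))" using half K0 ab by (intro mult_left_mono) auto
  finally show "norm (f b - f a) \<le> 2 * K * (b - a) * norm (f a)" by (simp only: mult_ac)
  show "f a = 0" if "f b = 0" using half[of b] m(2)[of a] ab that by simp
qed

text \<open>The interval is cut into equal pieces short enough for the previous lemma; on each of
  them a zero at the right end would force one at the left end.\<close>

lemma caratheodory_solution_nonzero:
  fixes F :: "'a::real_normed_vector \<Rightarrow> 'a"
  assumes "caratheodory_solution_on {a..b} F f" and "a \<le> b"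
    and K: "\<And>x. norm (F x) \<le> K * norm x" and K0: "0 \<le> K" and "f a \<noteq> 0"
  shows "f b \<noteq> 0"
proof -
  obtain n where "K * (b - a) \<le> real n / 2"
    using real_arch_simple[of "2 * (K * (b - a))"] by (auto simp: mult_ac)
  with assms(1,2) show ?thesis
  proof (induction n arbitrary: b)
    case 0
    then show ?case
      using caratheodory_solution_short_time(2)[OF 0(1,2) K K0] \<open>f a \<noteq> 0\<close> by auto
  next
    case (Suc n)
    \<comment> \<open>Cuts off the last of \<open>Suc n\<close> equal pieces.\<close>
    define c where "c = a + (b - a) * (n / Suc n)"
    have c: "a \<le> c" "c \<le> b"
      using Suc(3) mult_left_le[of "n / Suc n" "b - a"] by (auto simp: c_def)
    have ca: "K * (c - a) = K * (b - a) * n / Suc n" and bc: "K * (b - c) = K * (b - a) / Suc n"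
      by (auto simp: c_def field_simps)
    have "f c \<noteq> 0"
    proof (rule Suc.IH)
      have "K * (b - a) * n / Suc n \<le> real (Suc n) / 2 * n / Suc n"
        using Suc(4) by (intro divide_right_mono mult_right_mono) auto
      also have "\<dots> = n / 2" by (simp del: of_nat_Suc)
      finally show "K * (c - a) \<le> n / 2" unfolding ca .
      show "caratheodory_solution_on {a..c} F f"
        using Suc(2) c by (auto intro: caratheodory_solution_on_subset)
    qed (use c in auto)
    moreover have "K * (b - c) \<le> 1 / 2" unfolding bc using Suc(4) by (simp add: field_simps)
    moreover have "caratheodory_solution_on {c..b} F f"
      using Suc(2) c by (auto intro: caratheodory_solution_on_subset)
    ultimately show ?case
      using caratheodory_solution_short_time(2)[of c b F f K] K K0 c by blast
  qed
qed

section \<open>Pigeonhole and compactness arguments\<close>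

text \<open>If each of the \<open>R\<close> consecutive blocks of \<open>m\<close> steps took time
  at least \<open>e\<close>, their sum would be at least \<open>R * e\<close>.\<close>

lemma exists_short_block:
  fixes t :: "nat \<Rightarrow> real" and e :: real
  assumes "t (R * m) - t 0 < R * e"
  shows "\<exists>r<R. t (r * m + m) - t (r * m) < e"
proof (rule ccontr)
  assume neg: "\<not> ?thesis"
  have "k \<le> R \<Longrightarrow> t 0 + k * e \<le> t (k * m)" for k
  proof (induction k)
    case (Suc k)
    then have "k < R" by simp
    then have "e \<le> t (k * m + m) - t (k * m)" using neg not_less by blast
    with Suc show ?case by (simp add: algebra_simps)
  qed auto
  from this[of R] assms show False by simp
qed

text \<open>Finite approximate orbits of growing length, scaled to start on the compact unit sphere,
  have a subsequence whose starting points converge to some \<open>u\<close>. Induction on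
  \<open>i\<close> then carries the limit along: the \<open>i\<close>-th states tend to
  \<open>C^i u\<close>, and the closed hyperplane contains the limit.\<close>

lemma exists_orbit_in_hyperplane:
  fixes C :: "real^'n^'n" and lam :: "real^'n"
  assumes "\<And>m::nat. \<exists>y. y 0 \<noteq> 0 \<and> (\<forall>i\<le>m. lam \<bullet> y i = 0) \<and>
      (\<forall>i<m. norm (y (Suc i) - C *v y i) \<le> \<delta> m * norm (C *v y i))"
    and \<delta>: "\<delta> \<longlonglongrightarrow> 0"
  obtains u where "norm u = 1" "\<And>i. lam \<bullet> (matrix_power C i *v u) = 0"
proof -
  obtain y where y: "\<And>m. y m 0 \<noteq> 0" "\<And>m i. i \<le> m \<Longrightarrow> lam \<bullet> y m i = 0"
      "\<And>m i. i < m \<Longrightarrow> norm (y m (Suc i) - C *v y m i) \<le> \<delta> m * norm (C *v y m i)"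
    using assms(1) by metis
  define v where "v m i = y m i /\<^sub>R norm (y m 0)" for m i
  have "v m 0 \<in> sphere 0 1" for m using y(1) by (simp add: v_def)
  then obtain u \<sigma> where u: "u \<in> sphere 0 1" and \<sigma>: "strict_mono \<sigma>" "((\<lambda>m. v m 0) \<circ> \<sigma>) \<longlonglongrightarrow> u"
    using compact_sphere[of "0::real^'n" 1] unfolding compact_eq_seq_compact_metric seq_compact_def
    by metis
  \<comment> \<open>The orbit with index \<open>\<sigma> m\<close> is controlled up to position
    \<open>\<sigma> m\<close> only, so a fixed \<open>i\<close> is covered eventually.\<close>
  have ev: "\<forall>\<^sub>F m in sequentially. i < \<sigma> m" for i
    using eventually_compose_filterlim[OF eventually_gt_at_top filterlim_subseq[OF \<sigma>(1)]] .
  have lim: "(\<lambda>m. v (\<sigma> m) i) \<longlonglongrightarrow> matrix_power C i *v u" for i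
  proof (induction i)
    case 0
    then show ?case using \<sigma>(2) by (simp add: o_def)
  next
    case (Suc i)
    have Cv: "(\<lambda>m. C *v v (\<sigma> m) i) \<longlonglongrightarrow> C *v (matrix_power C i *v u)"
      by (intro bounded_linear.tendsto[OF matrix_vector_mul_bounded_linear] Suc)
    have "(\<lambda>m. \<delta> (\<sigma> m) * norm (C *v v (\<sigma> m) i)) \<longlonglongrightarrow> 0"
      using tendsto_mult[OF LIMSEQ_subseq_LIMSEQ[OF \<delta> \<sigma>(1)] tendsto_norm[OF Cv]] by (simp add: o_def)
    moreover have "\<forall>\<^sub>F m in sequentially.
        norm (v (\<sigma> m) (Suc i) - C *v v (\<sigma> m) i) \<le> \<delta> (\<sigma> m) * norm (C *v v (\<sigma> m) i)"
      using ev[of i]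
    proof eventually_elim
      case (elim m)
      have "v (\<sigma> m) (Suc i) - C *v v (\<sigma> m) i = (y (\<sigma> m) (Suc i) - C *v y (\<sigma> m) i) /\<^sub>R norm (y (\<sigma> m) 0)"
        by (simp add: v_def scaleR_diff_right matrix_vector_mult_scaleR)
      then show ?case using y(3)[OF elim] y(1)[of "\<sigma> m"]
        by (simp add: v_def matrix_vector_mult_scaleR divide_simps)
    qed
    ultimately have "(\<lambda>m. v (\<sigma> m) (Suc i) - C *v v (\<sigma> m) i) \<longlonglongrightarrow> 0"
      by (rule Lim_null_comparison[rotated])
    from tendsto_add[OF this Cv] show ?case by (simp add: matrix_vector_mul_assoc)
  qed
  have "lam \<bullet> (matrix_power C i *v u) = 0" for i
  proof (rule LIMSEQ_unique)
    show "(\<lambda>m. lam \<bullet> v (\<sigma> m) i) \<longlonglongrightarrow> lam \<bullet> (matrix_power C i *v u)"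
      by (intro tendsto_intros lim)
    show "(\<lambda>m. lam \<bullet> v (\<sigma> m) i) \<longlonglongrightarrow> 0"
      by (rule tendsto_eventually, use ev[of i] in eventually_elim) (simp add: v_def y(2))
  qed
  with u that show thesis by simp
qed

section \<open>Flows and jumps of hybrid solutions\<close>

lemma time_slice_iff: "t \<in> time_slice E j \<longleftrightarrow> (t, j) \<in> E"
  by (force simp: time_slice_def)

lemma hybrid_solution_slice:
  assumes "hybrid_solution A C lam E \<phi>" and "{a..b} \<subseteq> time_slice E j" and "a \<le> b"
  shows "caratheodory_solution_on {a..b} ((*v) A) (\<lambda>t. \<phi> (t, j))"
proof -
  let ?f = "\<lambda>t. \<phi> (t, j)"
  have ac: "absolutely_continuous_fun_on {a..b} ?f"
    using assms unfolding hybrid_solution_def hybrid_arc_def locally_absolutely_continuous_on_def by blast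
  have "\<exists>N. negligible N \<and> (\<forall>t\<in>{a..b} - N. (?f has_vector_derivative A *v ?f t) (at t within {a..b}))"
  proof (cases "a = b")
    case True
    \<comment> \<open>The slice may have empty interior here, where the differential equation is not
      imposed; the single point serves as the exceptional set.\<close>
    then show ?thesis by (intro exI[of _ "{a}"]) auto
  next
    case False
    then have "{a<..<b} \<noteq> {}" using assms(3) by simp
    then have "interior (time_slice E j) \<noteq> {}"
      using interior_mono[OF assms(2)] by auto
    then have "AE t in lebesgue. t \<in> time_slice E j \<longrightarrow>
        (?f has_vector_derivative (A *v ?f t)) (at t within time_slice E j)"
      using assms(1) unfolding hybrid_solution_def by blast
    then obtain N where "N \<in> null_sets lebesgue" "\<And>t. t \<notin> N \<Longrightarrow> t \<in> time_slice E j \<Longrightarrow>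
        (?f has_vector_derivative (A *v ?f t)) (at t within time_slice E j)"
      unfolding eventually_ae_filter by auto
    then show ?thesis using assms(2)
      by (meson DiffD1 DiffD2 has_vector_derivative_within_subset negligible_iff_null_sets subsetD)
  qed
  with ac show ?thesis unfolding caratheodory_solution_on_def by blast
qed

text \<open>Since the levels are unbounded, \<open>E\<close> has a point \<open>(T, J)\<close> with
  \<open>J > n\<close>. The partition of the compact piece below this point must reach level
  \<open>J\<close>, and it supplies the times.\<close>

lemma hybrid_time_domain_jump_times:
  assumes E: "hybrid_time_domain E" and unb: "\<not> bdd_above (snd ` E)"
  obtains t :: "nat \<Rightarrow> real" where "t 0 = 0" "\<And>j. j \<le> n \<Longrightarrow> t j \<le> t (Suc j)"
    "\<And>j. j \<le> n \<Longrightarrow> {t j..t (Suc j)} \<subseteq> time_slice E j"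
proof -
  obtain T J where TJ: "(T, J) \<in> E" "n < J"
    using unb unfolding bdd_above_def by (force simp: not_le)
  define D where "D = E \<inter> ({0..T} \<times> {0..J})"
  have "compact_hybrid_time_domain D" using E TJ unfolding hybrid_time_domain_def D_def by fast
  then obtain J' t where t: "J' \<ge> 1" "t 0 = (0::real)" "\<And>j. j < J' \<Longrightarrow> t j \<le> t (Suc j)"
      "D = (\<Union>j\<in>{0..<J'}. {t j..t (Suc j)} \<times> {j})"
    unfolding compact_hybrid_time_domain_def by blast
  \<comment> \<open>This shows \<open>0 \<le> T\<close>, so that the chosen point
    \<open>(T, J)\<close> itself lies in \<open>D\<close>.\<close>
  have "(0, 0) \<in> D" unfolding t(4) using t(1,2) t(3)[of 0] by (auto intro!: bexI[of _ 0])
  then have "(T, J) \<in> D" using TJ by (auto simp: D_def)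
  then have "J < J'" unfolding t(4) by auto
  moreover have "{t j..t (Suc j)} \<subseteq> time_slice E j" if "j < J'" for j
  proof
    fix s assume "s \<in> {t j..t (Suc j)}"
    then have "(s, j) \<in> D" unfolding t(4) using that by auto
    then show "s \<in> time_slice E j" by (simp add: D_def time_slice_iff)
  qed
  ultimately show thesis using t TJ(2) by (intro that[of t]) auto
qed

text \<open>Take for \<open>y i\<close> successive pre-jump states in a block of total flow time
  below \<open>\<epsilon>\<close>. A jump sends \<open>y i\<close> to \<open>C *v y i\<close>, and
  the short flow up to the next jump changes that vector by a relative error of at most
  \<open>2 * K * \<epsilon>\<close>.\<close>

lemma hybrid_solution_short_flow_block:
  fixes A C :: "real^'n^'n"
  assumes sol: "hybrid_solution A C lam E \<phi>" and C: "invertible C"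
    and bdd: "bounded (fst ` E)" and unb: "\<not> bdd_above (snd ` E)" and x0: "\<phi> (0, 0) \<noteq> 0"
    and K: "\<And>x. norm (A *v x) \<le> K * norm x" "0 \<le> K" and \<epsilon>: "0 < \<epsilon>" "K * \<epsilon> \<le> 1 / 2"
  shows "\<exists>y. y 0 \<noteq> 0 \<and> (\<forall>i\<le>m. lam \<bullet> y i = 0) \<and>
      (\<forall>i<m. norm (y (Suc i) - C *v y i) \<le> 2 * K * \<epsilon> * norm (C *v y i))"
proof -
  obtain B where B: "\<And>s j. (s, j) \<in> E \<Longrightarrow> \<bar>s\<bar> \<le> B"
    using bdd unfolding bounded_iff by force
  \<comment> \<open>With this \<open>R\<close>, blocks that each last at least
    \<open>\<epsilon>\<close> would together exceed the time bound \<open>B\<close>.\<close>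
  obtain R :: nat where R: "B / \<epsilon> < R" using reals_Archimedean2 by blast
  define n where "n = R * m + m"
  have "hybrid_time_domain E" using sol unfolding hybrid_solution_def hybrid_arc_def by blast
  \<comment> \<open>One level beyond \<open>n\<close> is requested because the jump out of level
    \<open>n\<close> lands in level \<open>n + 1\<close>.\<close>
  from hybrid_time_domain_jump_times[OF this unb, of "n + 1"]
  obtain t where t: "t 0 = 0" "\<And>j. j \<le> n + 1 \<Longrightarrow> t j \<le> t (Suc j)"
    "\<And>j. j \<le> n + 1 \<Longrightarrow> {t j..t (Suc j)} \<subseteq> time_slice E j"
    by blast
  have end_E: "(t (Suc j), j) \<in> E" and start_E: "(t j, j) \<in> E" if "j \<le> n + 1" for j
    using t(2,3)[OF that] by (auto simp: time_slice_iff[symmetric])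
  have jump: "lam \<bullet> \<phi> (t (Suc j), j) = 0" "\<phi> (t (Suc j), Suc j) = C *v \<phi> (t (Suc j), j)"
    if "j \<le> n" for j
    using sol end_E[of j] start_E[of "Suc j"] that unfolding hybrid_solution_def guard_def by auto
  have flow: "caratheodory_solution_on {t j..t (Suc j)} ((*v) A) (\<lambda>s. \<phi> (s, j))" if "j \<le> n" for j
    using that by (intro hybrid_solution_slice[OF sol] t) auto
  have nz: "\<phi> (t (Suc j), j) \<noteq> 0" if "j \<le> n" for j
    using that
  proof (induction j)
    case 0
    show ?case
      by (rule caratheodory_solution_nonzero[OF flow[OF 0] _ K]) (use t(1) t(2)[of 0] x0 in auto)
  next
    case (Suc j)
    then have "C *v \<phi> (t (Suc j), j) \<noteq> 0"
      using invertible_left_inverse[of C] C matrix_left_invertible_ker[of C] by auto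
    then have "\<phi> (t (Suc j), Suc j) \<noteq> 0" using jump(2)[of j] Suc.prems by simp
    then show ?case using t(2)[of "Suc j"] Suc.prems
      by (intro caratheodory_solution_nonzero[OF flow[OF Suc.prems] _ K]) auto
  qed
  have mono: "t i \<le> t j" if "i \<le> j" "j \<le> n + 1" for i j
    using that
  proof (induction j rule: dec_induct)
    case (step k)
    then show ?case using t(2)[of k] by auto
  qed auto
  have "t (R * m + 1) - t 1 < R * \<epsilon>"
  proof -
    have "t (Suc (R * m)) \<le> B" using B[OF end_E[of "R * m"]] by (simp add: n_def abs_le_iff)
    moreover have "0 \<le> t 1" using t(1) t(2)[of 0] by simp
    moreover have "B < R * \<epsilon>" using R \<epsilon>(1) by (simp add: field_simps)
    ultimately show ?thesis by simp
  qed
  \<comment> \<open>The index shift makes blocks begin and end at the final times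
    \<open>t (k + 1)\<close> of levels, that is, at pre-jump states.\<close>
  then obtain r where r: "r < R" "t (r * m + m + 1) - t (r * m + 1) < \<epsilon>"
    using exists_short_block[of "\<lambda>k. t (k + 1)" R m \<epsilon>] by auto
  define q where "q = r * m"
  have q: "q + m \<le> n" using r(1) by (simp add: q_def n_def)
  define y where "y i = \<phi> (t (Suc (q + i)), q + i)" for i
  have "norm (y (Suc i) - C *v y i) \<le> 2 * K * \<epsilon> * norm (C *v y i)" if i: "i < m" for i
  proof -
    define j where "j = Suc (q + i)"
    have jn: "j \<le> n" "j - 1 \<le> n" using i q by (auto simp: j_def)
    have le: "t j \<le> t (Suc j)" using t(2)[of j] jn by simp
    have "t (q + 1) \<le> t j" "t (Suc j) \<le> t (q + m + 1)"
      using i q by (auto simp: j_def intro!: mono)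
    then have s: "t (Suc j) - t j \<le> \<epsilon>" using r(2) by (simp add: q_def)
    then have "K * (t (Suc j) - t j) \<le> 1 / 2"
      using mult_left_mono[OF s K(2)] \<epsilon>(2) by linarith
    then have "norm (\<phi> (t (Suc j), j) - \<phi> (t j, j)) \<le> 2 * K * (t (Suc j) - t j) * norm (\<phi> (t j, j))"
      by (rule caratheodory_solution_short_time(1)[OF flow[OF jn(1)] le K])
    also have "\<dots> \<le> 2 * K * \<epsilon> * norm (\<phi> (t j, j))"
      using s K(2) by (intro mult_right_mono mult_left_mono) auto
    finally show ?thesis
      using jump(2)[of "q + i"] jn by (simp add: y_def j_def)
  qed
  moreover have "y 0 \<noteq> 0" "\<forall>i\<le>m. lam \<bullet> y i = 0"
    using nz[of q] jump(1) q by (auto simp: y_def)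
  ultimately show ?thesis by blast
qed

theorem theorem4:
  fixes A C :: "real^'n^'n" and lam x0 :: "real^'n"
    and E :: "(real \<times> nat) set" and \<phi> :: "real \<times> nat \<Rightarrow> real^'n"
  assumes "invertible C"
    and "lam \<noteq> 0"
    and "trivially_blocking C lam"
    and "x0 \<noteq> 0"
    and "hybrid_solution A C lam E \<phi>"
    and "\<phi> (0, 0) = x0"
  shows "\<not> zeno_solution A C lam E \<phi>"
proof
  assume "zeno_solution A C lam E \<phi>"
  then have Z: "bounded (fst ` E)" "\<not> bdd_above (snd ` E)" by (auto simp: zeno_solution_def)
  obtain K where K: "K > 0" "\<And>x. norm (A *v x) \<le> norm x * K"
    using bounded_linear.pos_bounded[OF matrix_vector_mul_bounded_linear] by blast
  \<comment> \<open>The relative error \<open>2 * K * \<epsilon> m\<close> becomes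
    \<open>1 / Suc m\<close>, which tends to 0, and the short-time condition holds for every
    \<open>m\<close>.\<close>
  define \<epsilon> where "\<epsilon> m = 1 / (2 * K * real (Suc m))" for m
  have \<epsilon>: "0 < \<epsilon> m" "K * \<epsilon> m \<le> 1 / 2" for m
  proof -
    show "0 < \<epsilon> m" using K(1) by (simp add: \<epsilon>_def)
    have eq: "K * \<epsilon> m = 1 / (2 * real (Suc m))" using K(1) by (simp add: \<epsilon>_def)
    show "K * \<epsilon> m \<le> 1 / 2" unfolding eq by (simp add: field_simps)
  qed
  have "(\<lambda>m. 2 * K * \<epsilon> m) = (\<lambda>m. 1 / real (Suc m))" using K(1) by (simp add: \<epsilon>_def)
  then have lim: "(\<lambda>m. 2 * K * \<epsilon> m) \<longlonglongrightarrow> 0" using LIMSEQ_Suc[OF lim_1_over_n] by simp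
  have "\<exists>y. y 0 \<noteq> 0 \<and> (\<forall>i\<le>m. lam \<bullet> y i = 0) \<and>
      (\<forall>i<m. norm (y (Suc i) - C *v y i) \<le> 2 * K * \<epsilon> m * norm (C *v y i))" for m
    by (rule hybrid_solution_short_flow_block[OF assms(5,1) Z _ _ _ \<epsilon>])
       (use assms(4,6) K in \<open>auto simp: mult.commute\<close>)
  from exists_orbit_in_hyperplane[OF this lim]
  obtain u where u: "norm u = 1" "\<And>i. lam \<bullet> (matrix_power C i *v u) = 0"
    by blast
  then have "u \<in> blocking_set_inf C lam" by (simp add: blocking_set_inf_def blocking_set_def)
  with assms(3) u(1) show False by (simp add: trivially_blocking_def)
qed

end
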